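(* Let $A\in\mathbb{F}^{n\times n}$ be nonsingular with at most $m$ nonzero entries per row, let $B\in\mathbb{F}^{n\times s}$ with $\|B\|=1$, and let $X_0=O$, $R_0=B$. Let $X_k\in\mathbb{F}^{n\times s}$ and $R_k\in\mathbb{F}^{n\times s}$ ($k\ge 1$) be the $k$th approximation and residual, respectively, generated in finite precision arithmetic by the recursions $$X_{j+1}=X_j+\alpha_jP_j,\qquad R_{j+1}=R_j-\alpha_j(AP_j),\qquad j=0,1,2,\dots,$$ with direction matrices $P_j\in\mathbb{F}^{n\times s}$ and scalars $\alpha_j\in\mathbb{F}$. Then the norm of the residual gap $G_{R_k}:=(B-AX_k)-R_k$ is bounded, up to terms of order $O(\mathbf{u}^2)$, by $$\|G_{R_k}\|\le k(5+2m)\,\mathbf{u}\,\|A\|\max_{0<j\le k}\|X_j\|+5(k+1)\,\mathbf{u}\max_{0\le j\le k}\|R_j\|.$$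
   Context: $\mathbb{F}\subset\mathbb{R}$ is the set of floating point numbers, $\mathrm{fl}(\cdot)$ denotes the result of a floating point computation, $\mathbf{u}$ is the unit roundoff, $\|\cdot\|$ is the Frobenius norm, and $m$ is the maximum number of nonzero entries per row of $A$. Here $s\ll n$. Rounding model, for $P,Q\in\mathbb{F}^{n\times s}$ and $\alpha\in\mathbb{F}$: $\mathrm{fl}(P+Q)=P+Q+E'$ with $\|E'\|\le\mathbf{u}(\|P\|+\|Q\|)$; $\mathrm{fl}(\alpha P)=\alpha P+E''$ with $\|E''\|\le\mathbf{u}\|\alpha P\|$; $\mathrm{fl}(AP)=AP+E'''$ with $\|E'''\|\le m\mathbf{u}\|A\|\|P\|$. Subtraction is treated like addition. Convention: terms of $O(\mathbf{u}^2)$ are omitted, and $\mathbf{u}\|\mathrm{fl}(\ast)\|$ is regarded as $\mathbf{u}\|\ast\|$. "Generated in finite precision arithmetic" means that the computed iterates satisfy $X_{j+1}=\mathrm{fl}(X_j+\mathrm{fl}(\alpha_jP_j))$ and $R_{j+1}=\mathrm{fl}(R_j-\mathrm{fl}(\alpha_j\,\mathrm{fl}(AP_j)))$. The quantities $P_j,\alpha_j$ are whatever (computed) values are supplied by the specific solver. In the definition of $G_{R_k}$ the expression $(B-AX_k)-R_k$ is evaluated exactly. *)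

theory Defs
  imports "HOL-Analysis.Analysis"
begin

text \<open>
  A matrix with rows indexed by \<open>'n\<close> and columns indexed by \<open>'s\<close> has type \<open>real ^ 's ^ 'n\<close>.
  The library \<open>norm\<close> on this type is the Euclidean norm of the vector of Euclidean row norms,
  that is, the Frobenius norm.
\<close>

definition matrices_over :: "real set \<Rightarrow> (real ^ 'b ^ 'a) set" where
  "matrices_over F = {M. \<forall>i j. M $ i $ j \<in> F}"

definition row_sparse :: "nat \<Rightarrow> real ^ 'b ^ 'a \<Rightarrow> bool" where
  "row_sparse m M \<longleftrightarrow> (\<forall>i. card {j. M $ i $ j \<noteq> 0} \<le> m)"

text \<open>
  The four functions give the computed result \<open>fl(\<dots>)\<close> of a sum, a difference, a scalar multiple
  and the product with \<open>A\<close>. Nothing is said here about these results lying in \<open>F\<close>: for a format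
  with bounded range that cannot hold for all operands. It is required in \<open>fp_iteration\<close> below,
  for the operations that are actually carried out.
\<close>

definition rounding_model ::
  "real set \<Rightarrow> real \<Rightarrow> nat \<Rightarrow> real ^ 'n ^ 'n
    \<Rightarrow> (real ^ 's ^ 'n \<Rightarrow> real ^ 's ^ 'n \<Rightarrow> real ^ 's ^ 'n)
    \<Rightarrow> (real ^ 's ^ 'n \<Rightarrow> real ^ 's ^ 'n \<Rightarrow> real ^ 's ^ 'n)
    \<Rightarrow> (real \<Rightarrow> real ^ 's ^ 'n \<Rightarrow> real ^ 's ^ 'n)
    \<Rightarrow> (real ^ 'n ^ 'n \<Rightarrow> real ^ 's ^ 'n \<Rightarrow> real ^ 's ^ 'n) \<Rightarrow> bool" where
  "rounding_model F u m A fl_add fl_sub fl_scale fl_mul \<longleftrightarrow>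
     (\<forall>P\<in>matrices_over F. \<forall>Q\<in>matrices_over F.
        \<exists>E. fl_add P Q = P + Q + E \<and> norm E \<le> u * (norm P + norm Q)) \<and>
     (\<forall>P\<in>matrices_over F. \<forall>Q\<in>matrices_over F.
        \<exists>E. fl_sub P Q = P - Q + E \<and> norm E \<le> u * (norm P + norm Q)) \<and>
     (\<forall>\<alpha>\<in>F. \<forall>P\<in>matrices_over F.
        \<exists>E. fl_scale \<alpha> P = \<alpha> *\<^sub>R P + E \<and> norm E \<le> u * norm (\<alpha> *\<^sub>R P)) \<and>
     (\<forall>P\<in>matrices_over F.
        \<exists>E. fl_mul A P = A ** P + E \<and> norm E \<le> real m * u * norm A * norm P)"

text \<open>
  \<open>k\<close> steps of the recursions in finite precision arithmetic. The directions \<open>P j\<close> and the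
  scalars \<open>\<alpha> j\<close> are arbitrary floating point data.
\<close>

definition fp_iteration ::
  "real set
    \<Rightarrow> (real ^ 's ^ 'n \<Rightarrow> real ^ 's ^ 'n \<Rightarrow> real ^ 's ^ 'n)
    \<Rightarrow> (real ^ 's ^ 'n \<Rightarrow> real ^ 's ^ 'n \<Rightarrow> real ^ 's ^ 'n)
    \<Rightarrow> (real \<Rightarrow> real ^ 's ^ 'n \<Rightarrow> real ^ 's ^ 'n)
    \<Rightarrow> (real ^ 'n ^ 'n \<Rightarrow> real ^ 's ^ 'n \<Rightarrow> real ^ 's ^ 'n)
    \<Rightarrow> real ^ 'n ^ 'n \<Rightarrow> nat
    \<Rightarrow> (nat \<Rightarrow> real) \<Rightarrow> (nat \<Rightarrow> real ^ 's ^ 'n)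
    \<Rightarrow> (nat \<Rightarrow> real ^ 's ^ 'n) \<Rightarrow> (nat \<Rightarrow> real ^ 's ^ 'n) \<Rightarrow> bool" where
  "fp_iteration F fl_add fl_sub fl_scale fl_mul A k \<alpha> P X R \<longleftrightarrow>
     (\<forall>j\<le>k. X j \<in> matrices_over F \<and> R j \<in> matrices_over F) \<and>
     (\<forall>j<k. \<alpha> j \<in> F \<and> P j \<in> matrices_over F \<and>
        fl_scale (\<alpha> j) (P j) \<in> matrices_over F \<and>
        fl_mul A (P j) \<in> matrices_over F \<and>
        fl_scale (\<alpha> j) (fl_mul A (P j)) \<in> matrices_over F \<and>
        X (Suc j) = fl_add (X j) (fl_scale (\<alpha> j) (P j)) \<and>
        R (Suc j) = fl_sub (R j) (fl_scale (\<alpha> j) (fl_mul A (P j))))"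

definition residual_gap ::
  "real ^ 'n ^ 'n \<Rightarrow> real ^ 's ^ 'n \<Rightarrow> real ^ 's ^ 'n \<Rightarrow> real ^ 's ^ 'n \<Rightarrow> real ^ 's ^ 'n" where
  "residual_gap A B X R = (B - A ** X) - R"

end

theory Submission
  imports Defs
begin

text \<open>
  The exact parts of one step cancel in the residual gap, so its increment is the sum of the five
  local rounding errors. These are controlled by the norms of the iterates because the computed update
  \<open>fl(\<alpha>\<^sub>jP\<^sub>j)\<close> is, up to its own rounding error, the difference \<open>X\<^sub>j\<^sub>+\<^sub>1 - X\<^sub>j\<close>, of norm at most
  \<open>2 max \<parallel>X\<^sub>i\<parallel>\<close>, and likewise for the residuals.
\<close>

text \<open>Each row of the product is a combination of the rows of \<open>B\<close> with
  coefficients from a row of \<open>A\<close>, so the triangle inequality and Cauchy-Schwarz bound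
  it. Taking the \<open>L2_set\<close> over the rows then gives the Frobenius norm.\<close>

lemma norm_matrix_mult_le:
  fixes A :: "real ^ 'm ^ 'n" and B :: "real ^ 'p ^ 'm"
  shows "norm (A ** B) \<le> norm A * norm B"
proof -
  have row: "norm ((A ** B) $ i) \<le> norm (A $ i) * norm B" for i
  proof -
    have "(A ** B) $ i = (\<Sum>l\<in>UNIV. A $ i $ l *\<^sub>R B $ l)"
      by (simp add: matrix_matrix_mult_def vec_eq_iff)
    then have "norm ((A ** B) $ i) \<le> (\<Sum>l\<in>UNIV. norm (A $ i $ l *\<^sub>R B $ l))"
      by (metis norm_sum)
    also have "\<dots> = (\<Sum>l\<in>UNIV. \<bar>A $ i $ l\<bar> * \<bar>norm (B $ l)\<bar>)"
      by simp
    also have "\<dots> \<le> L2_set (\<lambda>l. A $ i $ l) UNIV * L2_set (\<lambda>l. norm (B $ l)) UNIV"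
      by (rule L2_set_mult_ineq)
    also have "\<dots> = norm (A $ i) * norm B"
      by (simp add: norm_vec_def[of B] norm_vec_def[of "A $ i"] L2_set_def)
    finally show ?thesis .
  qed
  have "norm (A ** B) \<le> L2_set (\<lambda>i. norm (A $ i) * norm B) UNIV"
    unfolding norm_vec_def[of "A ** B"] by (rule L2_set_mono) (simp_all add: row)
  also have "\<dots> = norm A * norm B"
    by (simp add: norm_vec_def[of A] L2_set_left_distrib)
  finally show ?thesis .
qed

text \<open>The rounding error itself involves \<open>norm s\<close>; that term is absorbed on the
  left, leaving the factor \<open>1 - u\<close>.\<close>

lemma norm_computed_update_le:
  fixes x y s e :: "'a :: real_normed_vector"
  assumes "y = x + s + e" "norm e \<le> u * (norm x + norm s)"
    and "norm x \<le> M" "norm y \<le> M" "0 \<le> u" "u \<le> 1/2"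
  shows "norm s \<le> (2 + 6 * u) * M"
proof -
  have M: "0 \<le> M"
    using assms(3) norm_ge_zero order_trans by blast
  have "s = y - x - e"
    using assms(1) by simp
  then have "norm s \<le> norm y + norm x + norm e"
    by (metis norm_triangle_ineq4 add_right_mono order_trans)
  also have "\<dots> \<le> M + M + u * (M + norm s)"
    using assms by (intro add_mono order_trans[OF assms(2)] mult_left_mono) auto
  finally have "(1 - u) * norm s \<le> (2 + u) * M"
    by (simp add: algebra_simps)
  \<comment> \<open>The coefficient 6 makes \<open>2 + 6 * u\<close> a linear majorant of
    \<open>(2 + u) / (1 - u)\<close>: the inequality amounts to
    \<open>6 * u * u \<le> 3 * u\<close>, that is, to \<open>u \<le> 1/2\<close>.\<close>
  also have "\<dots> \<le> (1 - u) * ((2 + 6 * u) * M)"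
  proof -
    have "u * u \<le> u * (1/2)"
      using assms by (intro mult_left_mono) auto
    then have "2 + u \<le> (1 - u) * (2 + 6 * u)"
      by (simp add: algebra_simps)
    then show ?thesis
      using mult_right_mono[OF _ M] by (metis mult.assoc)
  qed
  finally show ?thesis
    using assms(6) by (simp add: mult_le_cancel_left)
qed

text \<open>The same absorption passes from the rounded scalar multiple \<open>s\<close> back to the
  exact one, \<open>p\<close>. Here 16 is chosen so that \<open>2 + 16 * u\<close> majorizes
  \<open>(2 + 6 * u) / (1 - u)\<close> for \<open>u \<le> 1/2\<close>.\<close>

lemma norm_exact_update_le:
  fixes p s e :: "'a :: real_normed_vector"
  assumes "s = p + e" "norm e \<le> u * norm p"
    and "norm s \<le> (2 + 6 * u) * M" "0 \<le> M" "0 \<le> u" "u \<le> 1/2"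
  shows "norm p \<le> (2 + 16 * u) * M"
proof -
  have "norm p \<le> norm s + norm e"
    using assms(1) norm_triangle_ineq4[of s e] by simp
  then have "(1 - u) * norm p \<le> (2 + 6 * u) * M"
    using assms(2,3) by (simp add: algebra_simps)
  also have "\<dots> \<le> (1 - u) * ((2 + 16 * u) * M)"
  proof -
    have "u * u \<le> u * (1/2)"
      using assms by (intro mult_left_mono) auto
    then have "2 + 6 * u \<le> (1 - u) * (2 + 16 * u)"
      by (simp add: algebra_simps)
    then show ?thesis
      using mult_right_mono[OF _ assms(4)] by (metis mult.assoc)
  qed
  finally show ?thesis
    using assms(6) by (simp add: mult_le_cancel_left)
qed

text \<open>Both \<open>A ** S\<close> and \<open>T\<close> contain the exact term
  \<open>\<alpha> *\<^sub>R (A ** P)\<close>, with opposite signs in the gap. The error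
  \<open>E3\<close> is made before the scaling and hence carries the factor
  \<open>\<alpha>\<close>.\<close>

lemma residual_gap_step:
  fixes A :: "real ^ 'n ^ 'n" and P X Y S E1 E2 :: "real ^ 's ^ 'n"
  assumes "S = \<alpha> *\<^sub>R P + E1" "Y = X + S + E2"
    and "Q = A ** P + E3" "T = \<alpha> *\<^sub>R Q + E4" "R' = R - T + E5"
  shows "residual_gap A B Y R' =
    residual_gap A B X R + (\<alpha> *\<^sub>R E3 + E4 - E5 - A ** E1 - A ** E2)"
  unfolding residual_gap_def assms
  by (simp add: matrix_add_ldistrib matrix_scalar_ac scalar_matrix_assoc algebra_simps
      flip: scalar_mult_eq_scaleR)

text \<open>To first order in \<open>u\<close>, the errors \<open>E1\<close>, \<open>E2\<close>,
  \<open>E3\<close> contribute 2, 1 + 2 and \<open>2 * m\<close> to the coefficient of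
  \<open>u * norm A * M\<close>, while \<open>E4\<close> and \<open>E5\<close> contribute 2 and 1 +
  2 to that of \<open>u * N\<close>. The second-order coefficients arise as 22 = 16 + 6 and
  \<open>16 * m\<close>.\<close>

lemma norm_residual_gap_step_le:
  fixes A :: "real ^ 'n ^ 'n" and P X Y S E1 E2 :: "real ^ 's ^ 'n"
  assumes S: "S = \<alpha> *\<^sub>R P + E1" "norm E1 \<le> u * norm (\<alpha> *\<^sub>R P)"
    and Y: "Y = X + S + E2" "norm E2 \<le> u * (norm X + norm S)"
    and Q: "Q = A ** P + E3" "norm E3 \<le> real m * u * norm A * norm P"
    and T: "T = \<alpha> *\<^sub>R Q + E4" "norm E4 \<le> u * norm (\<alpha> *\<^sub>R Q)"
    and R': "R' = R - T + E5" "norm E5 \<le> u * (norm R + norm T)"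
    and M: "norm X \<le> M" "norm Y \<le> M" "norm R \<le> N" "norm R' \<le> N"
    and u: "0 \<le> u" "u \<le> 1/2"
  shows "norm (residual_gap A B Y R') \<le> norm (residual_gap A B X R)
    + (u * norm A * ((5 + 2 * real m + (22 + 16 * real m) * u) * M) + u * ((5 + 22 * u) * N))"
proof -
  have M0: "0 \<le> M" and N0: "0 \<le> N"
    using M norm_ge_zero order_trans by blast+
  have s: "norm S \<le> (2 + 6 * u) * M"
    using norm_computed_update_le[OF Y M(1,2) u] .
  have p: "norm (\<alpha> *\<^sub>R P) \<le> (2 + 16 * u) * M"
    using norm_exact_update_le[OF S s M0 u] .
  \<comment> \<open>Subtracting \<open>T\<close> is read as adding \<open>- T\<close>.\<close>
  have t: "norm T \<le> (2 + 6 * u) * N"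
    using norm_computed_update_le[of R' R "- T" E5 u N] R' M(3,4) u by simp
  have q: "norm (\<alpha> *\<^sub>R Q) \<le> (2 + 16 * u) * N"
    using norm_exact_update_le[OF T t N0 u] .
  have 1: "norm (A ** E1) \<le> norm A * (u * ((2 + 16 * u) * M))"
    using S(2) mult_left_mono[OF p u(1)]
    by (intro order_trans[OF norm_matrix_mult_le] mult_left_mono) auto
  have "u * (norm X + norm S) \<le> u * (M + (2 + 6 * u) * M)"
    using M(1) s u(1) by (intro mult_left_mono add_mono)
  then have 2: "norm (A ** E2) \<le> norm A * (u * (M + (2 + 6 * u) * M))"
    using Y(2) by (intro order_trans[OF norm_matrix_mult_le] mult_left_mono) auto
  \<comment> \<open>Only the product of \<open>\<alpha>\<close> and \<open>P\<close> is controlled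
    by the iterates, so \<open>\<alpha>\<close> is moved next to \<open>P\<close> before
    estimating.\<close>
  have "norm (\<alpha> *\<^sub>R E3) \<le> \<bar>\<alpha>\<bar> * (real m * u * norm A * norm P)"
    using Q(2) by (simp add: mult_left_mono)
  also have "\<dots> = real m * u * norm A * norm (\<alpha> *\<^sub>R P)"
    by simp
  also have "\<dots> \<le> real m * u * norm A * ((2 + 16 * u) * M)"
    using p u(1) by (intro mult_left_mono) auto
  finally have 3: "norm (\<alpha> *\<^sub>R E3) \<le> real m * u * norm A * ((2 + 16 * u) * M)" .
  have 4: "norm E4 \<le> u * ((2 + 16 * u) * N)"
    using T(2) mult_left_mono[OF q u(1)] by linarith
  have "u * (norm R + norm T) \<le> u * (N + (2 + 6 * u) * N)"
    using M(3) t u(1) by (intro mult_left_mono add_mono)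
  then have 5: "norm E5 \<le> u * (N + (2 + 6 * u) * N)"
    using R'(2) by linarith
  have triangle: "norm (g + (a + b - c - d - e)) \<le> norm g + (norm a + norm b + norm c + norm d + norm e)"
    for g a b c d e :: "real ^ 's ^ 'n"
    by norm
  define G where "G = residual_gap A B X R"
  have "norm (residual_gap A B Y R') =
      norm (G + (\<alpha> *\<^sub>R E3 + E4 - E5 - A ** E1 - A ** E2))"
    unfolding G_def by (subst residual_gap_step[OF S(1) Y(1) Q(1) T(1) R'(1)]) rule
  also have "\<dots> \<le> norm G + (norm (\<alpha> *\<^sub>R E3) + norm E4 + norm E5 + norm (A ** E1) + norm (A ** E2))"
    by (rule triangle)
  also have "\<dots> \<le> norm G + (real m * u * norm A * ((2 + 16 * u) * M) + u * ((2 + 16 * u) * N)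
      + u * (N + (2 + 6 * u) * N) + norm A * (u * ((2 + 16 * u) * M))
      + norm A * (u * (M + (2 + 6 * u) * M)))"
    using 1 2 3 4 5 by linarith
  also have "\<dots> = norm G + (u * norm A * ((5 + 2 * real m + (22 + 16 * real m) * u) * M)
      + u * ((5 + 22 * u) * N))"
    by (simp add: algebra_simps)
  finally show ?thesis
    unfolding G_def .
qed

text \<open>The gap starts at zero, and since \<open>M\<close> and \<open>N\<close> bound all
  iterates up to \<open>k\<close>, every step adds at most the same amount
  \<open>?D\<close>.\<close>

lemma norm_residual_gap_le:
  fixes A :: "real ^ 'n ^ 'n" and X R :: "nat \<Rightarrow> real ^ 's ^ 'n"
  assumes model: "rounding_model F u m A fl_add fl_sub fl_scale fl_mul"
    and iter: "fp_iteration F fl_add fl_sub fl_scale fl_mul A k \<alpha> P X R"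
    and init: "X 0 = 0" "R 0 = B"
    and M: "\<And>j. j \<le> k \<Longrightarrow> norm (X j) \<le> M" and N: "\<And>j. j \<le> k \<Longrightarrow> norm (R j) \<le> N"
    and u: "0 \<le> u" "u \<le> 1/2"
  shows "norm (residual_gap A B (X k) (R k)) \<le>
    real k * (u * norm A * ((5 + 2 * real m + (22 + 16 * real m) * u) * M) + u * ((5 + 22 * u) * N))"
    (is "_ \<le> _ * ?D")
proof -
  have "norm (residual_gap A B (X i) (R i)) \<le> real i * ?D" if "i \<le> k" for i
    using that
  proof (induction i)
    case 0
    then show ?case
      by (simp add: init residual_gap_def)
  next
    case (Suc i)
    let ?S = "fl_scale (\<alpha> i) (P i)" and ?Q = "fl_mul A (P i)"
    let ?T = "fl_scale (\<alpha> i) ?Q"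
    \<comment> \<open>The rounding model speaks only of operands over \<open>F\<close>, so the
      intermediate results must be known to lie there too.\<close>
    have F: "X i \<in> matrices_over F" "R i \<in> matrices_over F" "\<alpha> i \<in> F" "P i \<in> matrices_over F"
      "?S \<in> matrices_over F" "?Q \<in> matrices_over F" "?T \<in> matrices_over F"
      and XR: "X (Suc i) = fl_add (X i) ?S" "R (Suc i) = fl_sub (R i) ?T"
      using iter Suc.prems unfolding fp_iteration_def by auto
    obtain E1 where E1: "?S = \<alpha> i *\<^sub>R P i + E1" "norm E1 \<le> u * norm (\<alpha> i *\<^sub>R P i)"
      using model F unfolding rounding_model_def by blast
    obtain E2 where E2: "X (Suc i) = X i + ?S + E2" "norm E2 \<le> u * (norm (X i) + norm ?S)"
      using model F XR unfolding rounding_model_def by metis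
    obtain E3 where E3: "?Q = A ** P i + E3" "norm E3 \<le> real m * u * norm A * norm (P i)"
      using model F unfolding rounding_model_def by blast
    obtain E4 where E4: "?T = \<alpha> i *\<^sub>R ?Q + E4" "norm E4 \<le> u * norm (\<alpha> i *\<^sub>R ?Q)"
      using model F unfolding rounding_model_def by blast
    obtain E5 where E5: "R (Suc i) = R i - ?T + E5" "norm E5 \<le> u * (norm (R i) + norm ?T)"
      using model F XR unfolding rounding_model_def by metis
    have "norm (residual_gap A B (X (Suc i)) (R (Suc i)))
        \<le> norm (residual_gap A B (X i) (R i)) + ?D"
      using Suc.prems
      by (intro norm_residual_gap_step_le[OF E1 E2 E3 E4 E5 _ _ _ _ u] M N) auto
    with Suc show ?case
      by (simp add: ring_distribs)
  qed
  then show ?thesis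
    by simp
qed

theorem theorem2p1:
  fixes m k :: nat
  assumes "k \<ge> 1"
  shows "\<exists>C. \<forall>\<^sub>F u in at_right (0::real).
    \<forall>(F :: real set)
      (fl_add :: real ^ 's ^ 'n \<Rightarrow> real ^ 's ^ 'n \<Rightarrow> real ^ 's ^ 'n)
      (fl_sub :: real ^ 's ^ 'n \<Rightarrow> real ^ 's ^ 'n \<Rightarrow> real ^ 's ^ 'n)
      (fl_scale :: real \<Rightarrow> real ^ 's ^ 'n \<Rightarrow> real ^ 's ^ 'n)
      (fl_mul :: real ^ 'n ^ 'n \<Rightarrow> real ^ 's ^ 'n \<Rightarrow> real ^ 's ^ 'n)
      (A :: real ^ 'n ^ 'n) (B :: real ^ 's ^ 'n)
      (\<alpha> :: nat \<Rightarrow> real) (P :: nat \<Rightarrow> real ^ 's ^ 'n)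
      (X :: nat \<Rightarrow> real ^ 's ^ 'n) (R :: nat \<Rightarrow> real ^ 's ^ 'n).
      A \<in> matrices_over F \<and> invertible A \<and> row_sparse m A \<and>
      B \<in> matrices_over F \<and> norm B = 1 \<and>
      rounding_model F u m A fl_add fl_sub fl_scale fl_mul \<and>
      X 0 = 0 \<and> R 0 = B \<and>
      fp_iteration F fl_add fl_sub fl_scale fl_mul A k \<alpha> P X R
      \<longrightarrow>
      norm (residual_gap A B (X k) (R k))
        \<le> real k * (5 + 2 * real m) * u * norm A * (MAX j\<in>{0<..k}. norm (X j))
          + 5 * (real k + 1) * u * (MAX j\<in>{0..k}. norm (R j))
          + C * u\<^sup>2 * (norm A * (MAX j\<in>{0<..k}. norm (X j)) + (MAX j\<in>{0..k}. norm (R j)))"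
proof (intro exI eventually_mono[OF eventually_at_right_real[of 0 "1/2"]] allI impI; (elim conjE)?)
  \<comment> \<open>The right neighbourhood of 0 is the interval \<open>(0, 1/2)\<close>, on which
    both absorption estimates hold.\<close>
  show "0 < (1/2 :: real)"
    by simp
next
  fix u :: real and F fl_add fl_sub fl_scale fl_mul A B \<alpha> P
    and X R :: "nat \<Rightarrow> real ^ 's ^ 'n"
  assume u: "u \<in> {0<..<1/2}"
    and model: "rounding_model F u m (A :: real ^ 'n ^ 'n) fl_add fl_sub fl_scale fl_mul"
    and init: "X 0 = 0" "R 0 = B"
    and iter: "fp_iteration F fl_add fl_sub fl_scale fl_mul A k \<alpha> P X R"
  let ?M = "MAX j\<in>{0<..k}. norm (X j)" and ?N = "MAX j\<in>{0..k}. norm (R j)"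
  have le_M: "norm (X j) \<le> ?M" if "0 < j" "j \<le> k" for j
    using that by (intro Max_ge) auto
  \<comment> \<open>The maximum omits the index 0, but \<open>X 0 = 0\<close> and \<open>?M\<close>
    is nonnegative, as \<open>k \<ge> 1\<close> makes its index set nonempty.\<close>
  have M: "norm (X j) \<le> ?M" if "j \<le> k" for j
  proof (cases "j = 0")
    case True
    then show ?thesis
      using init(1) order_trans[OF norm_ge_zero le_M[of k]] assms by simp
  next
    case False
    with that show ?thesis
      by (intro le_M) auto
  qed
  have N: "norm (R j) \<le> ?N" if "j \<le> k" for j
    using that by (intro Max_ge) auto
  have "0 \<le> ?M" "0 \<le> ?N"
    using M[of 0] N[of 0] norm_ge_zero order_trans by blast+
  \<comment> \<open>The first quantity raises the factor \<open>5 * k\<close> of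
    \<open>u * ?N\<close> to \<open>5 * (k + 1)\<close>; the second raises the coefficient of
    \<open>u\<^sup>2 * ?N\<close> to that of \<open>u\<^sup>2 * norm A * ?M\<close>, so that one
    constant serves both.\<close>
  then have slack: "0 \<le> 5 * u * ?N" "0 \<le> real k * (16 * real m) * u\<^sup>2 * ?N"
    using u by auto
  have "norm (residual_gap A B (X k) (R k)) \<le> real k *
      (u * norm A * ((5 + 2 * real m + (22 + 16 * real m) * u) * ?M) + u * ((5 + 22 * u) * ?N))"
    using u by (intro norm_residual_gap_le[OF model iter init M N]) auto
  also have "\<dots> \<le> real k *
      (u * norm A * ((5 + 2 * real m + (22 + 16 * real m) * u) * ?M) + u * ((5 + 22 * u) * ?N))
      + (5 * u * ?N + real k * (16 * real m) * u\<^sup>2 * ?N)"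
    using slack by linarith
  \<comment> \<open>The witness for \<open>C\<close> is read off here: it depends on
    \<open>k\<close> and \<open>m\<close> alone.\<close>
  also have "\<dots> = real k * (5 + 2 * real m) * u * norm A * ?M + 5 * (real k + 1) * u * ?N
      + (real k * (22 + 16 * real m)) * u\<^sup>2 * (norm A * ?M + ?N)"
    by (simp add: algebra_simps power2_eq_square)
  finally show "norm (residual_gap A B (X k) (R k))
      \<le> real k * (5 + 2 * real m) * u * norm A * ?M + 5 * (real k + 1) * u * ?N
        + (real k * (22 + 16 * real m)) * u\<^sup>2 * (norm A * ?M + ?N)" .
qed

end
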